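(* For every graph $G$ there exists an ordering $\sigma^*$ of $G$ such that for all $r\in\mathbb{N}$ we have \[\operatorname{scol}_r(G,\sigma^* )\le(2^r+1)\cdot\bigl(\operatorname{scol}_{2r}(G)\bigr)^{4r}.\]
   Context: All graphs $G=(V,E)$ are finite, simple and undirected. $\mathbb{N}$ denotes the positive integers. An ordering $\sigma$ of $G$ is a total ordering $<_\sigma$ of its vertex set $V$; $\Pi(G)$ denotes the set of all orderings of $G$. For $r\in\mathbb{N}$, $\sigma\in\Pi(G)$ and $x\in V$, a vertex $y$ is strongly $r$-reachable from $x$ with respect to $\sigma$ if $y\le_\sigma x$ and there is a path $P$ in $G$ from $x$ to $y$ with at most $r$ edges such that every vertex $p\in V(P)\setminus\{y\}$ satisfies $p\ge_\sigma x$. Let $S_r[G,\sigma,x]$ be the set of vertices strongly $r$-reachable from $x$ (it contains $x$ itself). Define $\operatorname{scol}_r(G,\sigma)=\max_{x\in V}|S_r[G,\sigma,x]|$ and $\operatorname{scol}_r(G)=\min_{\sigma\in\Pi(G)}\operatorname{scol}_r(G,\sigma)$. *)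

theory Defs
  imports "Graph_Theory.Pair_Digraph" "Graph_Theory.Vertex_Walk"
begin

text \<open>Finite simple undirected graphs are modelled by \<^locale>\<open>pair_graph\<close>: finite loopless
  digraphs, given by a set of pairs, whose arc relation is symmetric.\<close>

text \<open>An ordering is the reflexive relation: \<open>(x, y) \<in> \<sigma>\<close> means that \<open>x\<close> is at most \<open>y\<close> in \<open>\<sigma>\<close>.
  Since \<^const>\<open>linear_order_on\<close> confines \<open>\<sigma>\<close> to pairs of vertices, a finite graph
  has only finitely many orderings.\<close>

definition orderings :: "'a pair_pre_digraph \<Rightarrow> 'a rel set" where
  "orderings G = {\<sigma>. linear_order_on (pverts G) \<sigma>}"

definition strongly_reachable ::
  "nat \<Rightarrow> 'a pair_pre_digraph \<Rightarrow> 'a rel \<Rightarrow> 'a \<Rightarrow> 'a \<Rightarrow> bool" where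
  "strongly_reachable r G \<sigma> x y \<longleftrightarrow>
     (y, x) \<in> \<sigma> \<and>
     (\<exists>P. vpath P (with_proj G) \<and> hd P = x \<and> last P = y \<and> vwalk_length P \<le> r \<and>
          (\<forall>p \<in> set P - {y}. (x, p) \<in> \<sigma>))"

definition strong_reach :: "nat \<Rightarrow> 'a pair_pre_digraph \<Rightarrow> 'a rel \<Rightarrow> 'a \<Rightarrow> 'a set" where
  "strong_reach r G \<sigma> x = {y. strongly_reachable r G \<sigma> x y}"

text \<open>The inserted \<open>0\<close> only matters for the graph without vertices, where the maximum of the
  empty set is taken to be \<open>0\<close>.\<close>

definition scol_ord :: "nat \<Rightarrow> 'a pair_pre_digraph \<Rightarrow> 'a rel \<Rightarrow> nat" where
  "scol_ord r G \<sigma> = Max (insert 0 ((\<lambda>x. card (strong_reach r G \<sigma> x)) ` pverts G))"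

definition scol :: "nat \<Rightarrow> 'a pair_pre_digraph \<Rightarrow> nat" where
  "scol r G = Min (scol_ord r G ` orderings G)"

text \<open>The minimum defining \<^const>\<open>scol\<close> ranges over a finite nonempty set, and the sets
  \<^const>\<open>strong_reach\<close> are finite.\<close>

lemma finite_orderings: "finite (pverts G) \<Longrightarrow> finite (orderings G)"
  by (rule finite_subset[of _ "Pow (pverts G \<times> pverts G)"])
     (auto simp: orderings_def order_on_defs)

lemma orderings_nonempty: "orderings G \<noteq> {}"
  using well_order_on[of "pverts G"] by (auto simp: orderings_def well_order_on_def)

lemma strong_reach_subset: "\<sigma> \<in> orderings G \<Longrightarrow> strong_reach r G \<sigma> x \<subseteq> pverts G"
  by (auto simp: orderings_def order_on_defs strong_reach_def strongly_reachable_def)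

lemma self_in_strong_reach:
  "\<sigma> \<in> orderings G \<Longrightarrow> x \<in> pverts G \<Longrightarrow> x \<in> strong_reach r G \<sigma> x"
  by (auto simp: orderings_def order_on_defs refl_on_def strong_reach_def strongly_reachable_def
        vpath_def vwalk_def intro!: exI[of _ "[x]"])

end

theory Submission
  imports Defs
begin

text \<open>For each \<open>r\<close> fix an ordering \<open>\<sigma>\<^sub>r\<close> that is optimal for \<open>scol\<^bsub>2r\<^esub>\<close>. Iterating strong
  reachability bounds the number of vertices weakly \<open>r\<close>-reachable from a given one with respect to
  \<open>\<sigma>\<^sub>r\<close> by \<open>w\<^sub>r = scol\<^bsub>2r\<^esub>\<^sup>r\<close>. Hence, in any set \<open>U\<close> of vertices, a vertex is on average weakly
  \<open>r\<close>-reachable from at most \<open>w\<^sub>r\<close> members of \<open>U\<close>, and a Markov type argument with weights \<open>2\<^sup>-\<^sup>r\<close>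
  yields one vertex of \<open>U\<close> that is weakly \<open>r\<close>-reachable from at most \<open>2\<^sup>r w\<^sub>r\<close> members of \<open>U\<close>
  simultaneously for all \<open>r\<close>. Taking such a vertex as the last one and repeating this on the
  remaining vertices gives the uniform ordering. If \<open>y\<close> is strongly \<open>r\<close>-reachable from \<open>x\<close> with
  respect to it, the \<open>\<sigma>\<^sub>r\<close>-least vertex \<open>m\<close> of a witnessing path is weakly \<open>r\<close>-reachable from both
  \<open>x\<close> and \<open>y\<close>; either \<open>y = m\<close>, or \<open>m\<close> is not before \<open>x\<close> in the uniform ordering and so was chosen
  when \<open>y\<close> was still present. This leaves \<open>w\<^sub>r + w\<^sub>r (2\<^sup>r w\<^sub>r)\<close> possibilities for \<open>y\<close>.\<close>

section \<open>A simultaneous elimination ordering\<close>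

text \<open>A finite set of positive exponents lies in some \<open>{1..N}\<close>, where the
  geometric sum is \<open>1 - (1/2)^N\<close>. Strictness is what later leaves a vertex outside all
  bad sets.\<close>

lemma sum_inverse_powers_less_one:
  fixes R :: "nat set"
  assumes "finite R" "0 \<notin> R"
  shows "(\<Sum>r\<in>R. (1/2)^r :: real) < 1"
proof -
  obtain N where "R \<subseteq> {..N}"
    using assms(1) by (auto simp: finite_nat_set_iff_bounded_le)
  then have N: "R \<subseteq> {1..N}"
    using assms(2) by (force simp: Suc_le_eq intro: gr0I)
  have "(\<Sum>r\<in>R. (1/2)^r :: real) \<le> (\<Sum>r=1..N. (1/2)^r)"
    by (rule sum_mono2) (use N in auto)
  also have "\<dots> = 1 - (1/2)^N"
    by (induction N) auto
  also have "\<dots> < 1"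
    by simp
  finally show ?thesis .
qed

text \<open>Double counting of the pairs \<open>(u, m)\<close> with
  \<open>m \<in> W u\<close>.\<close>

lemma sum_card_preimages:
  fixes W :: "'a \<Rightarrow> 'a set"
  assumes "finite V"
  shows "(\<Sum>m\<in>V. card {u\<in>V. m \<in> W u}) = (\<Sum>u\<in>V. card (W u \<inter> V))"
proof -
  have "(\<Sum>m\<in>V. card {u\<in>V. m \<in> W u}) = (\<Sum>m\<in>V. \<Sum>u\<in>V. if m \<in> W u then 1 else 0)"
    using assms by (simp add: sum.If_cases Int_def)
  also have "\<dots> = (\<Sum>u\<in>V. \<Sum>m\<in>V. if m \<in> W u then 1 else 0)"
    by (rule sum.swap)
  also have "\<dots> = (\<Sum>u\<in>V. card (W u \<inter> V))"
    using assms by (simp add: sum.If_cases Int_def conj_commute)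
  finally show ?thesis .
qed

text \<open>A vertex of \<open>V\<close> is hit on average at most \<open>w r\<close> times, so by
  Markov's inequality at most a fraction \<open>(1/2)^r\<close> of \<open>V\<close> violates the
  bound for \<open>r\<close>. These fractions sum to less than 1.\<close>

lemma exists_simultaneously_rarely_hit:
  fixes W :: "nat \<Rightarrow> 'a \<Rightarrow> 'a set" and w :: "nat \<Rightarrow> nat"
  assumes fin: "finite V" and ne: "V \<noteq> {}"
    and W: "\<And>r u. r \<ge> 1 \<Longrightarrow> u \<in> V \<Longrightarrow> finite (W r u) \<and> card (W r u) \<le> w r"
  shows "\<exists>m\<in>V. \<forall>r\<ge>1. card {u\<in>V. m \<in> W r u} \<le> 2 ^ r * w r"
proof (rule ccontr)
  define d where "d r m = card {u\<in>V. m \<in> W r u}" for r m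
  define B where "B r = {m\<in>V. 2 ^ r * w r < d r m}" for r
  assume "\<not> ?thesis"
  then have "\<forall>m\<in>V. \<exists>r. r \<ge> 1 \<and> m \<in> B r"
    by (auto simp: B_def d_def not_le)
  \<comment> \<open>One violated radius per vertex suffices to cover \<open>V\<close>, so only
    finitely many radii enter the union bound.\<close>
  then obtain f where f: "\<And>m. m \<in> V \<Longrightarrow> f m \<ge> 1 \<and> m \<in> B (f m)"
    by metis
  have B_small: "real (card (B r)) \<le> (1/2)^r * card V" if r: "r \<ge> 1" for r
  proof (cases "w r = 0")
    \<comment> \<open>The Markov argument divides by \<open>w r\<close>; if \<open>w r = 0\<close>,
      nothing is hit and \<open>B r\<close> is empty.\<close>
    case True
    have "W r u = {}" if "u \<in> V" for u
      using W[OF r that] True card_0_eq by auto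
    then have "{u\<in>V. m \<in> W r u} = {}" for m
      by auto
    then have "d r m = 0" for m
      by (simp only: d_def card.empty)
    then show ?thesis
      by (simp add: B_def)
  next
    case False
    have "card (B r) * (2 ^ r * w r) = (\<Sum>m\<in>B r. 2 ^ r * w r)"
      by simp
    also have "\<dots> \<le> (\<Sum>m\<in>B r. d r m)"
      by (rule sum_mono) (auto simp: B_def)
    also have "\<dots> \<le> (\<Sum>m\<in>V. d r m)"
      by (rule sum_mono2) (use fin in \<open>auto simp: B_def\<close>)
    also have "\<dots> = (\<Sum>u\<in>V. card (W r u \<inter> V))"
      unfolding d_def by (rule sum_card_preimages[OF fin])
    also have "\<dots> \<le> (\<Sum>u\<in>V. w r)"
      by (rule sum_mono) (meson W card_mono inf_le1 order_trans r)
    also have "\<dots> = card V * w r"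
      by simp
    finally have "card (B r) * 2 ^ r \<le> card V"
      using False by simp
    then have "real (card (B r)) * 2 ^ r \<le> card V"
      by (metis of_nat_le_iff of_nat_mult of_nat_numeral of_nat_power)
    then show ?thesis
      by (simp add: power_one_over field_simps)
  qed
  have "V \<subseteq> (\<Union>r\<in>f ` V. B r)"
    using f by auto
  then have "card V \<le> card (\<Union>r\<in>f ` V. B r)"
    by (rule card_mono[rotated]) (use fin in \<open>auto simp: B_def\<close>)
  also have "\<dots> \<le> (\<Sum>r\<in>f ` V. card (B r))"
    by (rule card_UN_le) (use fin in auto)
  finally have "real (card V) \<le> (\<Sum>r\<in>f ` V. real (card (B r)))"
    by (metis of_nat_le_iff of_nat_sum)
  also have "\<dots> \<le> (\<Sum>r\<in>f ` V. (1/2)^r * card V)"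
    by (rule sum_mono) (use f B_small in auto)
  also have "\<dots> = (\<Sum>r\<in>f ` V. (1/2)^r) * card V"
    by (simp add: sum_distrib_right)
  also have "\<dots> < 1 * real (card V)"
  proof (rule mult_strict_right_mono)
    show "(\<Sum>r\<in>f ` V. (1/2)^r :: real) < 1"
      by (rule sum_inverse_powers_less_one) (use fin f in force)+
    show "0 < real (card V)"
      using fin ne by (simp add: card_gt_0_iff)
  qed
  finally show False
    by simp
qed

lemma linear_order_on_add_top:
  assumes "linear_order_on (V - {m}) \<sigma>" "m \<in> V"
  shows "linear_order_on V (\<sigma> \<union> V \<times> {m})"
proof -
  have "\<sigma> \<subseteq> (V - {m}) \<times> (V - {m})"
    using assms by (auto simp: order_on_defs)
  then show ?thesis
    using assms
    by (fastforce simp: order_on_defs refl_on_def total_on_def intro!: transI antisymI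
        dest: transD antisymD)
qed

text \<open>The ordering is built from the top: a rarely hit vertex becomes the last one, and
  induction orders the rest. The condition \<open>(u, m) \<in> \<sigma>\<close> says that
  \<open>u\<close> was still present when \<open>m\<close> was chosen.\<close>

lemma exists_elimination_order:
  fixes W :: "nat \<Rightarrow> 'a \<Rightarrow> 'a set" and w :: "nat \<Rightarrow> nat"
  assumes "finite V"
    and "\<And>r u. r \<ge> 1 \<Longrightarrow> u \<in> V \<Longrightarrow> finite (W r u) \<and> card (W r u) \<le> w r"
  shows "\<exists>\<sigma>. linear_order_on V \<sigma> \<and>
           (\<forall>m\<in>V. \<forall>r\<ge>1. card {u\<in>V. (u, m) \<in> \<sigma> \<and> m \<in> W r u} \<le> 2 ^ r * w r)"
  using assms
proof (induction V rule: finite_psubset_induct)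
  case (psubset V)
  show ?case
  proof (cases "V = {}")
    case True
    then show ?thesis
      by (auto intro!: exI[of _ "{}"])
  next
    case False
    then obtain m where m: "m \<in> V" "\<And>r. r \<ge> 1 \<Longrightarrow> card {u\<in>V. m \<in> W r u} \<le> 2 ^ r * w r"
      using exists_simultaneously_rarely_hit[of V W w] psubset by blast
    have "V - {m} \<subset> V"
      using m(1) by auto
    then have "\<exists>\<sigma>. linear_order_on (V - {m}) \<sigma> \<and> (\<forall>v\<in>V - {m}. \<forall>r\<ge>1.
        card {u\<in>V - {m}. (u, v) \<in> \<sigma> \<and> v \<in> W r u} \<le> 2 ^ r * w r)"
      by (rule psubset.IH) (use psubset.prems in simp)
    then obtain \<sigma> where \<sigma>: "linear_order_on (V - {m}) \<sigma>"
      and bound: "\<And>v r. v \<in> V - {m} \<Longrightarrow> r \<ge> 1 \<Longrightarrow>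
        card {u\<in>V - {m}. (u, v) \<in> \<sigma> \<and> v \<in> W r u} \<le> 2 ^ r * w r"
      by blast
    have sub: "\<sigma> \<subseteq> (V - {m}) \<times> (V - {m})"
      using \<sigma> by (auto simp: order_on_defs)
    have "card {u\<in>V. (u, v) \<in> \<sigma> \<union> V \<times> {m} \<and> v \<in> W r u} \<le> 2 ^ r * w r"
      if v: "v \<in> V" and r: "r \<ge> 1" for v r
    proof (cases "v = m")
      case True
      then have "{u\<in>V. (u, v) \<in> \<sigma> \<union> V \<times> {m} \<and> v \<in> W r u} = {u\<in>V. m \<in> W r u}"
        by auto
      then show ?thesis
        using m(2)[OF r] by simp
    next
      case False
      \<comment> \<open>The top vertex \<open>m\<close> is not below \<open>v\<close>, so it adds
        nothing to the count for \<open>v\<close>.\<close>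
      then have "{u\<in>V. (u, v) \<in> \<sigma> \<union> V \<times> {m} \<and> v \<in> W r u}
          = {u\<in>V - {m}. (u, v) \<in> \<sigma> \<and> v \<in> W r u}"
        using sub by auto
      then show ?thesis
        using bound[of v r] v r False by simp
    qed
    then show ?thesis
      using linear_order_on_add_top[OF \<sigma> m(1)] by blast
  qed
qed

section \<open>Weak reachability\<close>

text \<open>Here \<open>y\<close> is the least vertex of the whole path. That \<open>y\<close> is at
  most \<open>x\<close> follows, since \<open>x\<close> lies on \<open>P\<close>.\<close>

definition weakly_reachable ::
  "nat \<Rightarrow> 'a pair_pre_digraph \<Rightarrow> 'a rel \<Rightarrow> 'a \<Rightarrow> 'a \<Rightarrow> bool" where
  "weakly_reachable r G \<sigma> x y \<longleftrightarrow>
     (\<exists>P. vpath P (with_proj G) \<and> hd P = x \<and> last P = y \<and> vwalk_length P \<le> r \<and>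
          (\<forall>p \<in> set P. (y, p) \<in> \<sigma>))"

lemma vpath_appendD1: "vpath (p @ q) G \<Longrightarrow> p \<noteq> [] \<Longrightarrow> vpath p G"
  by (auto simp: vpath_def intro: vwalkI_append_l)

lemma vpath_appendD2: "vpath (p @ q) G \<Longrightarrow> q \<noteq> [] \<Longrightarrow> vpath q G"
  by (auto simp: vpath_def intro: vwalkI_append_r)

lemma vpath_rev:
  assumes "symmetric G" "vpath p G"
  shows "vpath (rev p) G"
  using assms
  by (auto simp: vpath_def vwalk_def set_vwalk_arcs_rev symmetric_def dest: symD)

lemma strong_reach_mono: "r \<le> s \<Longrightarrow> strong_reach r G \<sigma> x \<subseteq> strong_reach s G \<sigma> x"
  unfolding strong_reach_def strongly_reachable_def by fastforce

text \<open>Cut the path at its first vertex \<open>p\<close> below \<open>x\<close>: the initial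
  piece makes \<open>p\<close> strongly reachable from \<open>x\<close>, and the rest is a shorter
  witness from \<open>p\<close> to \<open>y\<close>. The radius \<open>r\<close> stays fixed while
  \<open>n\<close> drops, so a single relation is iterated.\<close>

lemma weakly_reachable_imp_relpow:
  assumes ord: "\<sigma> \<in> orderings G" and "n \<le> r" "weakly_reachable n G \<sigma> x y"
  shows "(x, y) \<in> {(u, v). v \<in> strong_reach r G \<sigma> u} ^^ n"
  using assms(2,3)
proof (induction n arbitrary: x)
  case 0
  then obtain P where "vpath P (with_proj G)" "hd P = x" "last P = y" "length P \<le> 1"
    by (auto simp: weakly_reachable_def)
  then show ?case
    by (cases P) (auto simp: vpath_def vwalk_def)
next
  case (Suc n)
  from Suc.prems obtain P where P: "vpath P (with_proj G)" "hd P = x" "last P = y"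
    "length P \<le> Suc (Suc n)" and low: "\<And>p. p \<in> set P \<Longrightarrow> (y, p) \<in> \<sigma>"
    by (auto simp: weakly_reachable_def)
  have "P \<noteq> []" and PV: "set P \<subseteq> pverts G"
    using P(1) by (auto simp: vpath_def vwalk_def)
  then have xP: "x \<in> set P" and yP: "y \<in> set P"
    using P by auto
  have lin: "linear_order_on (pverts G) \<sigma>"
    using ord by (simp add: orderings_def)
  have total: "(x, p) \<in> \<sigma>" if "p \<in> set P" "\<not> ((p, x) \<in> \<sigma> \<and> p \<noteq> x)" for p
  proof (cases "p = x")
    case True
    then show ?thesis
      using lin PV xP by (auto simp: order_on_defs refl_on_def)
  next
    case False
    then have "(x, p) \<in> \<sigma> \<or> (p, x) \<in> \<sigma>"
      using lin that(1) PV xP by (auto simp: order_on_defs total_on_def)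
    then show ?thesis
      using that(2) False by blast
  qed
  show ?case
  proof (cases "x = y")
    case True
    have "y \<in> strong_reach r G \<sigma> y"
      using self_in_strong_reach[OF ord] PV yP by blast
    moreover have "weakly_reachable n G \<sigma> y y"
      unfolding weakly_reachable_def
      by (rule exI[of _ "[y]"]) (use PV yP low in \<open>auto simp: vpath_self\<close>)
    ultimately show ?thesis
      using True Suc.IH[of y] Suc.prems(1) relpow_Suc_I2 by fastforce
  next
    case False
    then have "\<exists>p\<in>set P. (p, x) \<in> \<sigma> \<and> p \<noteq> x"
      using low[OF xP] yP by blast
    then obtain xs p ys where split: "P = xs @ p # ys" and p: "(p, x) \<in> \<sigma>" "p \<noteq> x"
      and xs: "\<And>q. q \<in> set xs \<Longrightarrow> \<not> ((q, x) \<in> \<sigma> \<and> q \<noteq> x)"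
      by (elim split_list_first_propE) blast
    \<comment> \<open>Thus the piece from \<open>p\<close> on has at least one edge fewer than
      \<open>P\<close>.\<close>
    have "xs \<noteq> []"
      using split P(2) p(2) by auto
    have "strongly_reachable r G \<sigma> x p"
      unfolding strongly_reachable_def
    proof (intro conjI exI)
      show "vpath (xs @ [p]) (with_proj G)"
        using P(1) split vpath_appendD1[of "xs @ [p]" ys] by simp
      show "hd (xs @ [p]) = x"
        using P(2) split \<open>xs \<noteq> []\<close> by simp
      show "vwalk_length (xs @ [p]) \<le> r"
        using P(4) split Suc.prems(1) by simp
      show "\<forall>q\<in>set (xs @ [p]) - {p}. (x, q) \<in> \<sigma>"
        using total xs split by auto
    qed (use p in simp_all)
    moreover have "weakly_reachable n G \<sigma> p y"
      unfolding weakly_reachable_def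
    proof (intro conjI exI)
      show "vpath (p # ys) (with_proj G)"
        using P(1) split vpath_appendD2[of xs "p # ys"] by simp
      show "last (p # ys) = y"
        using P(3) split by simp
      show "vwalk_length (p # ys) \<le> n"
        using P(4) split \<open>xs \<noteq> []\<close> by (cases xs) auto
      show "\<forall>q\<in>set (p # ys). (y, q) \<in> \<sigma>"
        using low split by auto
    qed simp
    ultimately show ?thesis
      using Suc.IH[of p] Suc.prems(1)
      by (intro relpow_Suc_I2[of x p]) (simp_all add: strong_reach_def)
  qed
qed

lemma finite_card_relpow_Image_le:
  fixes R :: "'a rel"
  assumes "\<And>x. finite (R `` {x})" "\<And>x. card (R `` {x}) \<le> s"
  shows "finite ((R ^^ n) `` {x}) \<and> card ((R ^^ n) `` {x}) \<le> s ^ n"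
proof (induction n)
  case 0
  have "(R ^^ 0) `` {x} = {x}"
    by auto
  then show ?case
    by simp
next
  case (Suc n)
  have eq: "(R ^^ Suc n) `` {x} = (\<Union>z\<in>(R ^^ n) `` {x}. R `` {z})"
    by auto
  have "card (\<Union>z\<in>(R ^^ n) `` {x}. R `` {z}) \<le> (\<Sum>z\<in>(R ^^ n) `` {x}. card (R `` {z}))"
    by (rule card_UN_le) (use Suc in simp)
  also have "\<dots> \<le> (\<Sum>z\<in>(R ^^ n) `` {x}. s)"
    by (rule sum_mono) (rule assms)
  also have "\<dots> \<le> s ^ n * s"
    using Suc by simp
  finally show ?case
    unfolding eq using Suc assms(1) by (auto simp: mult.commute)
qed

text \<open>Outside the graph the set is empty, so the bound holds for every \<open>x\<close> of the
  type, as the iteration count demands.\<close>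

lemma card_strong_reach_le:
  assumes "finite (pverts G)" "\<sigma> \<in> orderings G"
  shows "card (strong_reach r G \<sigma> x) \<le> scol_ord r G \<sigma>"
proof (cases "x \<in> pverts G")
  case True
  then show ?thesis
    unfolding scol_ord_def using assms(1) by (intro Max_ge) auto
next
  case False
  then have "strong_reach r G \<sigma> x = {}"
    using assms(2)
    by (auto simp: orderings_def order_on_defs strong_reach_def strongly_reachable_def)
  then show ?thesis
    by simp
qed

lemma finite_card_weak_reach_le:
  assumes "finite (pverts G)" "\<sigma> \<in> orderings G"
  shows "finite {y. weakly_reachable r G \<sigma> x y}"
    and "card {y. weakly_reachable r G \<sigma> x y} \<le> scol_ord (2 * r) G \<sigma> ^ r"
proof -
  define R where "R = {(u, v). v \<in> strong_reach r G \<sigma> u}"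
  have R: "R `` {x} = strong_reach r G \<sigma> x" for x
    by (auto simp: R_def)
  have fin: "finite (strong_reach k G \<sigma> x)" for k x
    using assms finite_subset strong_reach_subset by metis
  \<comment> \<open>Enlarging the radius to \<open>2 * r\<close> expresses the bound in the
    parameter for which the ordering will be optimal.\<close>
  have "card (strong_reach r G \<sigma> x) \<le> scol_ord (2 * r) G \<sigma>" for x
    using card_mono[OF fin strong_reach_mono[of r "2 * r" G \<sigma> x]]
      card_strong_reach_le[OF assms, of "2 * r" x] by simp
  then have *: "finite ((R ^^ r) `` {x}) \<and> card ((R ^^ r) `` {x}) \<le> scol_ord (2 * r) G \<sigma> ^ r"
    by (intro finite_card_relpow_Image_le) (auto simp: R fin)
  have sub: "{y. weakly_reachable r G \<sigma> x y} \<subseteq> (R ^^ r) `` {x}"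
    using weakly_reachable_imp_relpow[OF assms(2) order_refl] by (auto simp: R_def)
  show "finite {y. weakly_reachable r G \<sigma> x y}"
    using * sub finite_subset by blast
  show "card {y. weakly_reachable r G \<sigma> x y} \<le> scol_ord (2 * r) G \<sigma> ^ r"
    using * sub card_mono by (meson order_trans)
qed

lemma linear_order_on_finite_has_least:
  assumes "linear_order_on V \<sigma>" "finite A" "A \<noteq> {}" "A \<subseteq> V"
  shows "\<exists>m\<in>A. \<forall>p\<in>A. (m, p) \<in> \<sigma>"
  using assms(2-)
proof (induction A rule: finite_ne_induct)
  case (singleton a)
  then show ?case
    using assms(1) by (auto simp: order_on_defs refl_on_def)
next
  case (insert a A)
  then obtain m where m: "m \<in> A" "\<forall>p\<in>A. (m, p) \<in> \<sigma>"
    by auto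
  moreover have "(a, a) \<in> \<sigma>" "(a, m) \<in> \<sigma> \<or> (m, a) \<in> \<sigma>"
    using assms(1) insert m by (auto simp: order_on_defs refl_on_def total_on_def)
  moreover have "trans \<sigma>"
    using assms(1) by (simp add: order_on_defs)
  ultimately show ?case
    by (auto dest: transD)
qed

text \<open>Cutting the path at \<open>m\<close> serves its head; reversing it first, by symmetry,
  serves its last vertex.\<close>

lemma weakly_reachable_from_path_ends:
  assumes sym: "symmetric (with_proj G)" and P: "vpath P (with_proj G)" "vwalk_length P \<le> r"
    and m: "m \<in> set P" "\<forall>p\<in>set P. (m, p) \<in> \<sigma>"
  shows "weakly_reachable r G \<sigma> (hd P) m" and "weakly_reachable r G \<sigma> (last P) m"
proof -
  have *: "weakly_reachable r G \<sigma> (hd Q) m"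
    if Q: "vpath Q (with_proj G)" "vwalk_length Q \<le> r" "m \<in> set Q" "\<forall>p\<in>set Q. (m, p) \<in> \<sigma>" for Q
  proof -
    obtain xs ys where split: "Q = xs @ m # ys"
      using Q(3) by (meson split_list)
    then have "vpath (xs @ [m]) (with_proj G)"
      using Q(1) vpath_appendD1[of "xs @ [m]" ys] by simp
    then show ?thesis
      unfolding weakly_reachable_def
      by (intro exI[of _ "xs @ [m]"]) (use Q split in \<open>auto simp: hd_append\<close>)
  qed
  show "weakly_reachable r G \<sigma> (hd P) m"
    using * P m by blast
  show "weakly_reachable r G \<sigma> (last P) m"
    using *[of "rev P"] vpath_rev[OF sym P(1)] P(2) m by (simp add: hd_rev)
qed

text \<open>Let \<open>m\<close> be the \<open>\<tau>\<close>-least vertex of a path witnessing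
  strong reachability for \<open>\<sigma>\<close>. Either \<open>y = m\<close>, which lies in
  \<open>W x\<close>, or the path condition puts \<open>m\<close> at or above \<open>x\<close>,
  hence above \<open>y\<close>, in \<open>\<sigma>\<close>.\<close>

lemma strong_reach_subset_via_weak_reach:
  fixes r :: nat
  assumes sym: "symmetric (with_proj G)" and \<tau>: "\<tau> \<in> orderings G" and \<sigma>: "\<sigma> \<in> orderings G"
  defines "W \<equiv> \<lambda>x. {y. weakly_reachable r G \<tau> x y}"
  shows "strong_reach r G \<sigma> x \<subseteq> W x \<union> (\<Union>m\<in>W x. {u\<in>pverts G. (u, m) \<in> \<sigma> \<and> m \<in> W u})"
proof
  fix y assume "y \<in> strong_reach r G \<sigma> x"
  then obtain P where yx: "(y, x) \<in> \<sigma>" and P: "vpath P (with_proj G)" "hd P = x" "last P = y"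
    "vwalk_length P \<le> r" and above: "\<And>p. p \<in> set P \<Longrightarrow> p \<noteq> y \<Longrightarrow> (x, p) \<in> \<sigma>"
    by (auto simp: strong_reach_def strongly_reachable_def)
  have PV: "set P \<subseteq> pverts G" "P \<noteq> []"
    using P(1) by (auto simp: vpath_def vwalk_def)
  then obtain m where m: "m \<in> set P" "\<forall>p\<in>set P. (m, p) \<in> \<tau>"
    using linear_order_on_finite_has_least[of "pverts G" \<tau> "set P"] \<tau>
    by (auto simp: orderings_def)
  have mW: "m \<in> W x" "m \<in> W y"
    using weakly_reachable_from_path_ends[OF sym P(1,4) m] P(2,3) by (auto simp: W_def)
  show "y \<in> W x \<union> (\<Union>m\<in>W x. {u\<in>pverts G. (u, m) \<in> \<sigma> \<and> m \<in> W u})"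
  proof (cases "m = y")
    case False
    have "trans \<sigma>"
      using \<sigma> by (simp add: orderings_def order_on_defs)
    then have "(y, m) \<in> \<sigma>"
      using yx above[OF m(1) False] by (rule transD)
    moreover have "y \<in> pverts G"
      using PV P(3) by auto
    ultimately show ?thesis
      using mW by auto
  qed (use mW in simp)
qed

section \<open>The uniform ordering\<close>

theorem theorem1p4:
  fixes G :: "'a pair_pre_digraph"
  assumes "pair_graph G"
  shows "\<exists>\<sigma> \<in> orderings G. \<forall>r \<ge> 1.
           scol_ord r G \<sigma> \<le> (2 ^ r + 1) * scol (2 * r) G ^ (4 * r)"
proof -
  interpret pair_graph G
    by fact
  have fin: "finite (pverts G)" and sym: "symmetric (with_proj G)"
    using pair_sym_arcs by auto
  have "\<exists>\<tau>\<in>orderings G. scol_ord (2 * r) G \<tau> = scol (2 * r) G" for r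
  proof -
    have "scol (2 * r) G \<in> scol_ord (2 * r) G ` orderings G"
      unfolding scol_def
      using finite_orderings[OF fin] orderings_nonempty[of G] by (intro Min_in) auto
    then show ?thesis
      by auto
  qed
  \<comment> \<open>The optimal ordering \<open>\<tau> r\<close> depends on \<open>r\<close>; only
    \<open>\<sigma>\<close> below is common to all radii.\<close>
  then obtain \<tau> where \<tau>: "\<And>r. \<tau> r \<in> orderings G"
    and opt: "\<And>r. scol_ord (2 * r) G (\<tau> r) = scol (2 * r) G"
    by metis
  define W where "W r x = {y. weakly_reachable r G (\<tau> r) x y}" for r x
  define w where "w r = scol (2 * r) G ^ r" for r
  have W: "finite (W r x)" "card (W r x) \<le> w r" for r x
    using finite_card_weak_reach_le[OF fin \<tau>[of r], of r x] by (auto simp: W_def w_def opt)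
  obtain \<sigma> where "linear_order_on (pverts G) \<sigma>"
    and hit: "\<And>m r. m \<in> pverts G \<Longrightarrow> r \<ge> 1 \<Longrightarrow>
      card {u\<in>pverts G. (u, m) \<in> \<sigma> \<and> m \<in> W r u} \<le> 2 ^ r * w r"
    using exists_elimination_order[of "pverts G" W w] fin W by blast
  then have \<sigma>: "\<sigma> \<in> orderings G"
    by (simp add: orderings_def)
  have "card (strong_reach r G \<sigma> x) \<le> (2 ^ r + 1) * scol (2 * r) G ^ (4 * r)"
    if r: "r \<ge> 1" for r x
  proof -
    let ?U = "\<lambda>m. {u\<in>pverts G. (u, m) \<in> \<sigma> \<and> m \<in> W r u}"
    \<comment> \<open>The bound \<open>hit\<close> speaks of vertices of the graph only.\<close>
    have W_verts: "W r x \<subseteq> pverts G"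
      by (auto simp: W_def weakly_reachable_def vpath_def vwalk_def)
    have "card (strong_reach r G \<sigma> x) \<le> card (W r x \<union> (\<Union>m\<in>W r x. ?U m))"
      using strong_reach_subset_via_weak_reach[OF sym \<tau>[of r] \<sigma>, of r x] W fin
      by (intro card_mono) (auto simp: W_def)
    also have "\<dots> \<le> card (W r x) + (\<Sum>m\<in>W r x. card (?U m))"
      by (rule order_trans[OF card_Un_le]) (intro add_left_mono card_UN_le W)
    also have "\<dots> \<le> card (W r x) + (\<Sum>m\<in>W r x. 2 ^ r * w r)"
      using hit r W_verts by (intro add_left_mono sum_mono) auto
    also have "\<dots> \<le> w r + w r * (2 ^ r * w r)"
      using W(2)[of r x] by (simp add: add_mono mult_le_mono1)
    \<comment> \<open>A natural number is at most its square, also when it is 0.\<close>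
    also have "\<dots> \<le> (2 ^ r + 1) * (w r * w r)"
      by (simp add: algebra_simps)
    also have "\<dots> = (2 ^ r + 1) * scol (2 * r) G ^ (2 * r)"
      by (simp add: w_def mult_2 power_add)
    \<comment> \<open>If \<open>scol (2 * r) G\<close> is 0, as for the graph without vertices, both
      powers vanish because \<open>r \<ge> 1\<close>; otherwise powers increase with the
      exponent.\<close>
    also have "\<dots> \<le> (2 ^ r + 1) * scol (2 * r) G ^ (4 * r)"
      using r by (intro mult_left_mono; cases "scol (2 * r) G = 0")
        (auto simp: power_0_left intro: power_increasing)
    finally show ?thesis .
  qed
  then have "scol_ord r G \<sigma> \<le> (2 ^ r + 1) * scol (2 * r) G ^ (4 * r)" if "r \<ge> 1" for r
    unfolding scol_ord_def using fin that by (intro Max.boundedI) auto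
  then show ?thesis
    using \<sigma> by blast
qed

end
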